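(* Let $\mathcal{V}$ be a separable Hilbert space over $\mathbb{K}=\mathbb{R}$ or $\mathbb{C}$ and let $\mathcal{A}\in\mathcal{L}(\mathcal{V},\mathcal{V}')$. The following assertions are equivalent: (i) the operator $\mathcal{A}$ is essentially coercive; (ii) there exists a finite rank operator $\mathcal{K}:\mathcal{V}\to\mathcal{V}'$ such that $\mathcal{A}+\mathcal{K}$ is coercive; (iii) there exists a compact operator $\mathcal{K}:\mathcal{V}\to\mathcal{V}'$ such that $\mathcal{A}+\mathcal{K}$ is coercive.
   Context: $\mathcal{V}'$ is the space of continuous antilinear functionals on $\mathcal{V}$ (the usual dual if $\mathbb{K}=\mathbb{R}$), with pairing $\langle L,v\rangle$; $\mathcal{L}(\mathcal{V},\mathcal{V}')$ is the space of bounded linear operators. Finite rank operators are understood to be bounded and linear. An operator $\mathcal{B}\in\mathcal{L}(\mathcal{V},\mathcal{V}')$ is coercive if there is $\alpha>0$ with $|\langle\mathcal{B}u,u\rangle|\ge\alpha\|u\|_{\mathcal{V}}^2$ for all $u\in\mathcal{V}$. It is essentially coercive if for each sequence $(u_n)$ in $\mathcal{V}$ converging weakly to $0$ with $\lim_{n\to\infty}\langle\mathcal{B}u_n,u_n\rangle=0$, one has $\lim_{n\to\infty}\|u_n\|_{\mathcal{V}}=0$. *)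

theory Defs
  imports "HOL-Analysis.Analysis"
begin

(* The scalar field. An instance is the field of real or of complex numbers up to isometric
   isomorphism: to_complex identifies it, as a normed field, with \<real> or with \<complex>. *)
class real_or_complex = real_normed_field +
  fixes to_complex :: "'a \<Rightarrow> complex"
    and conjugate :: "'a \<Rightarrow> 'a"
  assumes to_complex_add: "to_complex (x + y) = to_complex x + to_complex y"
    and to_complex_mult: "to_complex (x * y) = to_complex x * to_complex y"
    and to_complex_scaleR: "to_complex (scaleR r x) = r *\<^sub>R to_complex x"
    and norm_to_complex: "cmod (to_complex x) = norm x"
    and range_to_complex: "range to_complex = \<real> \<or> range to_complex = UNIV"
    and to_complex_conjugate: "to_complex (conjugate x) = cnj (to_complex x)"

instantiation real :: real_or_complex
begin
definition to_complex_real :: "real \<Rightarrow> complex" where "to_complex_real = complex_of_real"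
definition conjugate_real :: "real \<Rightarrow> real" where "conjugate_real = id"
instance
  by standard (auto simp: to_complex_real_def conjugate_real_def Reals_def scaleR_conv_of_real)
end

instantiation complex :: real_or_complex
begin
definition to_complex_complex :: "complex \<Rightarrow> complex" where "to_complex_complex = id"
definition conjugate_complex :: "complex \<Rightarrow> complex" where "conjugate_complex = cnj"
instance
  by standard (auto simp: to_complex_complex_def conjugate_complex_def)
end

(* A Hilbert space over 'k. Completeness is part of the class banach; the norm and the real
   scalar multiplication of that class are tied to ip and scl by the assumptions.
   The inner product is linear in its first argument. *)
locale hilbert_space = vector_space scl
  for scl :: "'k::real_or_complex \<Rightarrow> 'v::banach \<Rightarrow> 'v" +
  fixes ip :: "'v \<Rightarrow> 'v \<Rightarrow> 'k"
  assumes scale_of_real: "scl (of_real r) x = r *\<^sub>R x"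
    and ip_add_left: "ip (x + y) z = ip x z + ip y z"
    and ip_scale_left: "ip (scl c x) y = c * ip x y"
    and ip_commute: "ip y x = conjugate (ip x y)"
    and ip_self: "ip x x = of_real ((norm x)\<^sup>2)"

lemma hilbert_space_real_inner:
  "hilbert_space scaleR (inner :: 'v::{real_inner, banach} \<Rightarrow> 'v \<Rightarrow> real)"
  by unfold_locales
    (auto simp: conjugate_real_def inner_commute inner_add_left algebra_simps power2_norm_eq_inner)

lemma hilbert_space_complex: "hilbert_space (*) (\<lambda>x y :: complex. x * cnj y)"
  by unfold_locales
    (auto simp: conjugate_complex_def algebra_simps scaleR_conv_of_real simp flip: complex_norm_square)

(* The space V' of continuous antilinear functionals, as a subset of the bounded real-linear
   maps; the norm inherited from that type is the dual norm. *)
definition antidual :: "('k::real_or_complex \<Rightarrow> 'v::real_normed_vector \<Rightarrow> 'v) \<Rightarrow> ('v \<Rightarrow>\<^sub>L 'k) set"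
  where "antidual scl =
    {L. \<forall>c v. blinfun_apply L (scl c v) = conjugate c * blinfun_apply L v}"

definition dual_scale :: "'k::real_or_complex \<Rightarrow> ('v::real_normed_vector \<Rightarrow>\<^sub>L 'k) \<Rightarrow> ('v \<Rightarrow>\<^sub>L 'k)"
  where "dual_scale c L = blinfun_mult_right c o\<^sub>L L"

lemma dual_scale_apply [simp]: "blinfun_apply (dual_scale c L) v = c * blinfun_apply L v"
  by (simp add: dual_scale_def)

interpretation dual: vector_space dual_scale
  by unfold_locales (auto intro!: blinfun_eqI simp: blinfun.add_left algebra_simps)

(* The bounded 'k-linear operators from V to V'. *)
definition operators ::
  "('k::real_or_complex \<Rightarrow> 'v::real_normed_vector \<Rightarrow> 'v) \<Rightarrow> ('v \<Rightarrow>\<^sub>L ('v \<Rightarrow>\<^sub>L 'k)) set"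
  where "operators scl =
    {B. range (blinfun_apply B) \<subseteq> antidual scl \<and>
        Vector_Spaces.linear scl dual_scale (blinfun_apply B)}"

definition pairing :: "('v::real_normed_vector \<Rightarrow>\<^sub>L 'k::real_or_complex) \<Rightarrow> 'v \<Rightarrow> 'k"
  where "pairing L v = blinfun_apply L v"

definition coercive :: "('v::real_normed_vector \<Rightarrow>\<^sub>L ('v \<Rightarrow>\<^sub>L 'k::real_or_complex)) \<Rightarrow> bool"
  where "coercive B \<longleftrightarrow>
    (\<exists>\<alpha>>0. \<forall>u. norm (pairing (blinfun_apply B u) u) \<ge> \<alpha> * (norm u)\<^sup>2)"

definition weakly_converges ::
  "('k::real_or_complex \<Rightarrow> 'v::real_normed_vector \<Rightarrow> 'v) \<Rightarrow> (nat \<Rightarrow> 'v) \<Rightarrow> 'v \<Rightarrow> bool"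
  where "weakly_converges scl u x \<longleftrightarrow>
    (\<forall>L\<in>antidual scl. (\<lambda>n. pairing L (u n)) \<longlonglongrightarrow> pairing L x)"

definition essentially_coercive ::
  "('k::real_or_complex \<Rightarrow> 'v::real_normed_vector \<Rightarrow> 'v) \<Rightarrow> ('v \<Rightarrow>\<^sub>L ('v \<Rightarrow>\<^sub>L 'k)) \<Rightarrow> bool"
  where "essentially_coercive scl B \<longleftrightarrow>
    (\<forall>u. weakly_converges scl u 0 \<longrightarrow>
         (\<lambda>n. pairing (blinfun_apply B (u n)) (u n)) \<longlonglongrightarrow> 0 \<longrightarrow>
         (\<lambda>n. norm (u n)) \<longlonglongrightarrow> 0)"

(* The range is a finite-dimensional subspace over 'k. *)
definition finite_rank :: "('v::real_normed_vector \<Rightarrow>\<^sub>L ('v \<Rightarrow>\<^sub>L 'k::real_or_complex)) \<Rightarrow> bool"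
  where "finite_rank K \<longleftrightarrow> (\<exists>F. finite F \<and> range (blinfun_apply K) = dual.span F)"

definition compact_operator ::
  "('v::real_normed_vector \<Rightarrow>\<^sub>L 'w::real_normed_vector) \<Rightarrow> bool"
  where "compact_operator K \<longleftrightarrow>
    (\<forall>S. bounded S \<longrightarrow> compact (closure (blinfun_apply K ` S)))"

end

theory Submission
  imports Defs
begin

text \<open>The step with content goes from essential coercivity to a finite rank perturbation. Take a dense
sequence \<open>d\<^sub>0, d\<^sub>1, \<dots>\<close> and let \<open>W\<^sub>n\<close> be the orthogonal complement of
\<open>d\<^sub>0, \<dots>, d\<^sub>n\<^sub>-\<^sub>1\<close>. Unit vectors \<open>u\<^sub>n \<in> W\<^sub>n\<close> converge weakly to \<open>0\<close>, because every
functional is represented by a vector that some \<open>d\<^sub>i\<close> approximates. If \<open>|\<langle>A u, u\<rangle>|\<close> had no positive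
lower bound on the unit sphere of any \<open>W\<^sub>n\<close>, one could choose the \<open>u\<^sub>n\<close> with
\<open>\<langle>A u\<^sub>n, u\<^sub>n\<rangle> \<longlonglongrightarrow> 0\<close>, against essential coercivity. So \<open>A\<close> is coercive on a subspace \<open>W\<close> of finite
codimension (\<open>essentially_coercive_imp_coercive_finite_codim\<close>).

It remains to correct \<open>A\<close> on the finite-dimensional complement without destroying coercivity on \<open>W\<close>.
A lower bound for \<open>|\<langle>A w, w\<rangle>|\<close> does not suffice for this, since the correction might cancel
\<open>\<langle>A w, w\<rangle>\<close>. The numerical range of \<open>A\<close> on \<open>W\<close> is convex, however (\<open>toeplitz_hausdorff\<close>), and it keeps
a positive distance from \<open>0\<close>. After multiplication by a scalar \<open>d \<noteq> 0\<close> it therefore lies in a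
half-plane \<open>Re z \<ge> \<beta> > 0\<close> (\<open>coercive_form_in_half_plane\<close>). If \<open>P\<close> is the orthogonal projection onto the
complement of \<open>W\<close>, then for large \<open>l\<close> the form \<open>d \<langle>A u, u\<rangle> + l \<parallel>P u\<parallel>\<^sup>2\<close> has real part at least
\<open>(\<beta>/2) \<parallel>u\<parallel>\<^sup>2\<close>: the mixed terms are absorbed by Young's inequality. Hence the perturbation is the
operator \<open>u \<mapsto> (l/d) \<langle>P u, \<cdot>\<rangle>\<close> of finite rank
(\<open>finite_codim_coercive_imp_finite_rank_perturbation\<close>).

The other two steps are short. A finite rank operator is compact because its values are combinations of
finitely many fixed functionals, with coefficients that are bounded on bounded sets
(\<open>finite_rank_imp_compact_operator\<close>). If \<open>A + K\<close> is coercive with \<open>K\<close> compact, and \<open>u\<^sub>n\<close> refutes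
essential coercivity of \<open>A\<close>, normalise a subsequence that stays away from \<open>0\<close>; then
\<open>\<langle>K u\<^sub>n, u\<^sub>n\<rangle> \<longlonglongrightarrow> 0\<close> along a further subsequence, so that \<open>\<langle>(A + K) u\<^sub>n, u\<^sub>n\<rangle> \<longlonglongrightarrow> 0\<close> for unit vectors
(\<open>compact_perturbation_imp_essentially_coercive\<close>).

All arguments treat the real and the complex case at once. The embedding \<^const>\<open>to_complex\<close> into the
complex numbers supplies real parts, and the two cases separate only in \<open>real_functional\<close>
and in the closedness of the range of \<^const>\<open>to_complex\<close>.\<close>

section \<open>Scalars\<close>

lemma bounded_linear_to_complex: "bounded_linear (to_complex :: 'k::real_or_complex \<Rightarrow> complex)"
  by (rule bounded_linear_intro[where K = 1])
     (simp_all add: to_complex_add to_complex_scaleR norm_to_complex)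

lemmas to_complex_zero [simp] = linear_0[OF bounded_linear.linear[OF bounded_linear_to_complex]]
lemmas to_complex_diff = linear_diff[OF bounded_linear.linear[OF bounded_linear_to_complex]]

lemma to_complex_eq_iff [simp]: "to_complex (x :: 'k::real_or_complex) = to_complex y \<longleftrightarrow> x = y"
  using norm_to_complex[of "x - y"] by (auto simp: to_complex_diff)

lemma to_complex_one [simp]: "to_complex (1 :: 'k::real_or_complex) = 1"
  using to_complex_mult[of "1 :: 'k" 1] norm_to_complex[of "1 :: 'k"] by auto

lemma to_complex_power: "to_complex (x ^ n) = to_complex (x :: 'k::real_or_complex) ^ n"
  by (induction n) (simp_all add: to_complex_mult)

lemma to_complex_of_real [simp]: "to_complex (of_real r :: 'k::real_or_complex) = of_real r"
  by (simp add: of_real_def to_complex_scaleR)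

lemma conjugate_add: "conjugate (x + y) = conjugate x + conjugate (y :: 'k::real_or_complex)"
  by (subst to_complex_eq_iff[symmetric]) (simp add: to_complex_conjugate to_complex_add)

lemma conjugate_mult: "conjugate (x * y) = conjugate x * conjugate (y :: 'k::real_or_complex)"
  by (subst to_complex_eq_iff[symmetric]) (simp add: to_complex_conjugate to_complex_mult)

lemma conjugate_conjugate [simp]: "conjugate (conjugate x) = (x :: 'k::real_or_complex)"
  by (subst to_complex_eq_iff[symmetric]) (simp add: to_complex_conjugate)

lemma conjugate_of_real [simp]: "conjugate (of_real r) = (of_real r :: 'k::real_or_complex)"
  by (subst to_complex_eq_iff[symmetric]) (simp add: to_complex_conjugate)

lemma conjugate_zero [simp]: "conjugate 0 = (0 :: 'k::real_or_complex)"
  using conjugate_of_real[of 0] by simp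

lemma norm_conjugate [simp]: "norm (conjugate x) = norm (x :: 'k::real_or_complex)"
  using norm_to_complex[of x] norm_to_complex[of "conjugate x"] by (simp add: to_complex_conjugate)

lemma mult_conjugate: "x * conjugate x = (of_real ((norm x)\<^sup>2) :: 'k::real_or_complex)"
  using complex_norm_square[of "to_complex x"]
  by (subst to_complex_eq_iff[symmetric])
     (simp add: to_complex_conjugate to_complex_mult to_complex_power norm_to_complex)

lemma bounded_linear_conjugate: "bounded_linear (conjugate :: 'k::real_or_complex \<Rightarrow> 'k)"
  by (rule bounded_linear_intro[where K = 1])
     (simp_all add: conjugate_add scaleR_conv_of_real conjugate_mult)

lemma Re_ge_neg_norm: "- norm k \<le> Re (to_complex (k :: 'k::real_or_complex))"
  using abs_Re_le_cmod[of "to_complex k"] unfolding norm_to_complex by linarith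

lemma phase:
  fixes z :: "'k::real_or_complex"
  obtains c where "norm c = 1" "c * z = of_real (norm z)"
proof (cases "z = 0")
  case True
  then show ?thesis by (intro that[of 1]) simp_all
next
  case False
  have "conjugate z / of_real (norm z) * z = of_real (norm z)"
    using False mult_conjugate[of z] by (simp add: mult.commute power2_eq_square)
  then show ?thesis
    using False by (intro that[of "conjugate z / of_real (norm z)"]) (simp_all add: norm_divide)
qed

text \<open>Over the complex numbers the scalar is the conjugate of \<open>h\<close>. Over the reals the imaginary part of
\<open>h\<close> pairs with zero and can be dropped. This turns a separating hyperplane in the plane into
multiplication by a scalar of the given field.\<close>

lemma real_functional:
  obtains d :: "'k::real_or_complex" where "\<And>k. Re (to_complex (d * k)) = inner h (to_complex k)"
  using range_to_complex[where 'a = 'k]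
proof
  assume R: "range (to_complex :: 'k \<Rightarrow> complex) = \<real>"
  have "Im (to_complex k) = 0" for k :: 'k
    using R rangeI[of to_complex k] by (simp add: complex_is_Real_iff)
  then have "Re (to_complex (of_real (Re h) * k)) = inner h (to_complex k)" for k :: 'k
    by (simp add: to_complex_mult inner_complex_def)
  then show ?thesis by (rule that)
next
  assume "range (to_complex :: 'k \<Rightarrow> complex) = UNIV"
  then obtain d :: 'k where "to_complex d = cnj h" by (metis rangeE UNIV_I)
  then have "Re (to_complex (d * k)) = inner h (to_complex k)" for k
    by (simp add: to_complex_mult inner_complex_def)
  then show ?thesis by (rule that)
qed

text \<open>The ball is an isometric copy of the intersection of a disc with the closed range of
\<^const>\<open>to_complex\<close>.\<close>

lemma compact_cball_scalar: "compact (cball (0 :: 'k::real_or_complex) r)"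
proof -
  let ?R = "range (to_complex :: 'k \<Rightarrow> complex)"
  let ?g = "inv (to_complex :: 'k \<Rightarrow> complex)"
  have inj: "inj (to_complex :: 'k \<Rightarrow> complex)"
    by (simp add: inj_def)
  have "closed ?R"
    using range_to_complex[where 'a = 'k] closed_complex_Reals by auto
  then have "compact (cball 0 r \<inter> ?R)"
    by (simp add: compact_Int_closed)
  moreover have "continuous_on (cball 0 r \<inter> ?R) ?g"
    unfolding continuous_on_iff
  proof (intro ballI allI impI)
    fix x e assume x: "x \<in> cball 0 r \<inter> ?R" and "e > (0 :: real)"
    have "dist (?g y) (?g x) = dist y x" if "y \<in> ?R" for y
    proof -
      from that x obtain a b :: 'k where "x = to_complex a" "y = to_complex b" by auto
      with inj norm_to_complex[of "b - a"] show ?thesis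
        by (simp add: dist_norm to_complex_diff)
    qed
    then show "\<exists>d>0. \<forall>y\<in>cball 0 r \<inter> ?R. dist y x < d \<longrightarrow> dist (?g y) (?g x) < e"
      using \<open>e > 0\<close> by auto
  qed
  ultimately have "compact (?g ` (cball 0 r \<inter> ?R))"
    by (rule compact_continuous_image[rotated])
  moreover have "?g ` (cball 0 r \<inter> ?R) = cball 0 r"
  proof (intro equalityI subsetI)
    fix c :: 'k assume "c \<in> cball 0 r"
    then have "to_complex c \<in> cball 0 r \<inter> ?R" by (simp add: norm_to_complex)
    then show "c \<in> ?g ` (cball 0 r \<inter> ?R)"
      by (metis image_eqI inj inv_f_f)
  qed (use inj in \<open>auto simp: norm_to_complex\<close>)
  ultimately show ?thesis by simp
qed

section \<open>Hilbert spaces\<close>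

context hilbert_space
begin

lemma scaleR_eq_scale: "r *\<^sub>R x = scl (of_real r) x"
  by (simp add: scale_of_real)

lemma ip_add_right: "ip x (y + z) = ip x y + ip x z"
  using ip_commute[of x "y + z"] ip_commute[of x y] ip_commute[of x z]
  by (simp add: ip_add_left conjugate_add)

lemma ip_scale_right: "ip x (scl c y) = conjugate c * ip x y"
  using ip_commute[of x "scl c y"] ip_commute[of x y]
  by (simp add: ip_scale_left conjugate_mult)

lemma ip_zero_left [simp]: "ip 0 y = 0"
  using ip_add_left[of 0 0 y] by simp

lemma ip_zero_right [simp]: "ip x 0 = 0"
  using ip_add_right[of x 0 0] by simp

lemma ip_minus_left: "ip (- x) y = - ip x y"
  using ip_add_left[of x "- x" y] by (simp add: eq_neg_iff_add_eq_0 add.commute)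

lemma ip_minus_right: "ip x (- y) = - ip x y"
  using ip_add_right[of x y "- y"] by (simp add: eq_neg_iff_add_eq_0 add.commute)

lemma ip_diff_left: "ip (x - y) z = ip x z - ip y z"
  using ip_add_left[of x "- y" z] by (simp add: ip_minus_left)

lemma ip_diff_right: "ip x (y - z) = ip x y - ip x z"
  using ip_add_right[of x y "- z"] by (simp add: ip_minus_right)

lemma ip_sum_left: "ip (sum f S) y = (\<Sum>s\<in>S. ip (f s) y)"
  by (induction S rule: infinite_finite_induct) (simp_all add: ip_add_left)

lemma ip_eq_0_commute: "ip x y = 0 \<longleftrightarrow> ip y x = 0"
  by (metis ip_commute norm_conjugate norm_eq_zero)

lemma ip_self_eq_1: "norm x = 1 \<Longrightarrow> ip x x = 1"
  by (simp add: ip_self)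

lemma ip_self_eq_power: "(of_real (norm x))\<^sup>2 = ip x x"
  by (simp add: ip_self)

lemma norm_power2_eq: "(norm x)\<^sup>2 = Re (to_complex (ip x x))"
  by (simp only: ip_self to_complex_of_real Re_complex_of_real)

lemma norm_scale: "norm (scl c x) = norm c * norm x"
proof -
  have "(of_real ((norm (scl c x))\<^sup>2) :: 'k) = of_real ((norm c * norm x)\<^sup>2)"
    using mult_conjugate[of c, symmetric]
    by (simp add: ip_scale_left ip_scale_right power_mult_distrib ip_self_eq_power)
  then show ?thesis
    by (simp only: of_real_eq_iff) simp
qed

lemma pythagoras:
  assumes "ip x y = 0"
  shows "(norm (x + y))\<^sup>2 = (norm x)\<^sup>2 + (norm y)\<^sup>2"
proof -
  have "(of_real ((norm (x + y))\<^sup>2) :: 'k) = of_real ((norm x)\<^sup>2 + (norm y)\<^sup>2)"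
    using assms ip_eq_0_commute[of x y]
    by (simp add: ip_add_left ip_add_right ip_self_eq_power)
  then show ?thesis
    by (simp only: of_real_eq_iff)
qed

lemma Cauchy_Schwarz: "norm (ip x y) \<le> norm x * norm y"
proof (cases "y = 0")
  case False
  define c where "c = ip x y / of_real ((norm y)\<^sup>2)"
  have "ip (x - scl c y) (scl c y) = 0"
    using False by (simp add: ip_diff_left ip_scale_left ip_scale_right ip_self c_def)
  from pythagoras[OF this] have "(norm c * norm y)\<^sup>2 \<le> (norm x)\<^sup>2"
    by (simp add: norm_scale)
  then have "norm c * norm y \<le> norm x"
    by (rule power2_le_imp_le) simp
  moreover have "norm c * norm y = norm (ip x y) / norm y"
    using False by (simp add: c_def norm_divide norm_power) (simp add: power2_eq_square)
  ultimately show ?thesis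
    using False by (simp add: pos_divide_le_eq)
qed simp

lemma parallelogram:
  fixes x y :: 'v
  shows "(norm (x + y))\<^sup>2 + (norm (x - y))\<^sup>2 = 2 * (norm x)\<^sup>2 + 2 * (norm y)\<^sup>2"
  unfolding norm_power2_eq
  by (simp add: ip_add_left ip_add_right ip_diff_left ip_diff_right to_complex_add to_complex_diff)

text \<open>This expansion along a real line is what the variational argument for the Riesz theorem
differentiates.\<close>

lemma norm_add_scaleR:
  "(norm (x + t *\<^sub>R y))\<^sup>2 = (norm x)\<^sup>2 + 2 * t * Re (to_complex (ip x y)) + t\<^sup>2 * (norm y)\<^sup>2"
  unfolding norm_power2_eq scaleR_eq_scale
  by (simp add: ip_add_left ip_add_right ip_scale_left ip_scale_right to_complex_add
      to_complex_mult ip_commute[of y x] to_complex_conjugate algebra_simps power2_eq_square)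

definition represent :: "'v \<Rightarrow> 'v \<Rightarrow>\<^sub>L 'k"
  where "represent g = Blinfun (ip g)"

lemma represent_apply [simp]: "blinfun_apply (represent g) v = ip g v"
proof -
  have "bounded_linear (ip g)"
    by (rule bounded_linear_intro[where K = "norm g"])
       (auto simp: ip_add_right scaleR_eq_scale ip_scale_right scaleR_conv_of_real mult.commute
         intro: order_trans[OF Cauchy_Schwarz])
  then show ?thesis
    by (simp add: represent_def bounded_linear_Blinfun_apply)
qed

text \<open>The representing vector is the minimiser of the strictly convex functional
\<open>J v = \<parallel>v\<parallel>\<^sup>2 - 2 Re (L v)\<close>. By the parallelogram identity every minimising sequence is Cauchy.
At the minimiser the derivative \<open>2 Re (\<langle>g, v\<rangle> - L v)\<close> vanishes in every direction \<open>v\<close>, and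
replacing \<open>v\<close> by scalar multiples removes the real part.\<close>

theorem riesz_representation:
  assumes L: "L \<in> antidual scl"
  obtains g where "L = represent g"
proof -
  define J where "J v = (norm v)\<^sup>2 - 2 * Re (to_complex (blinfun_apply L v))" for v
  have bdd: "bdd_below (range J)"
  proof (rule bdd_belowI2)
    fix v
    have "Re (to_complex (blinfun_apply L v)) \<le> norm L * norm v"
      using complex_Re_le_cmod[of "to_complex (blinfun_apply L v)"] norm_blinfun[of L v]
      by (simp add: norm_to_complex)
    moreover have "2 * (norm L * norm v) \<le> (norm L)\<^sup>2 + (norm v)\<^sup>2"
      using sum_squares_bound[of "norm L" "norm v"] by simp
    ultimately show "- (norm L)\<^sup>2 \<le> J v"
      unfolding J_def by linarith
  qed
  define m where "m = Inf (range J)"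
  have m_le: "m \<le> J v" for v
    unfolding m_def using bdd by (rule cInf_lower[rotated]) simp
  define \<delta> where "\<delta> n = 1 / real (Suc n)" for n
  have "\<exists>v. J v < m + \<delta> n" for n
    using cInf_lessD[of "range J" "m + \<delta> n"] by (auto simp: m_def \<delta>_def)
  then obtain x where x: "J (x n) < m + \<delta> n" for n by metis
  have dist_le: "(norm (u - v))\<^sup>2 \<le> 2 * (J u - m) + 2 * (J v - m)" for u v
  proof -
    have "J ((1/2) *\<^sub>R z) = (norm z)\<^sup>2 / 4 - Re (to_complex (blinfun_apply L z))" for z
      by (simp add: J_def blinfun.scaleR_right to_complex_scaleR power_divide)
    then have "J u + J v = 2 * J ((1/2) *\<^sub>R (u + v)) + (norm (u - v))\<^sup>2 / 2"
      using parallelogram[of u v]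
      by (simp add: J_def blinfun.add_right to_complex_add del: scaleR_add_right)
    then show ?thesis using m_le[of "(1/2) *\<^sub>R (u + v)"] by simp
  qed
  have "Cauchy x"
  proof (rule metric_CauchyI)
    fix e :: real assume "e > 0"
    then obtain N where N: "\<delta> N < e\<^sup>2 / 4"
      unfolding \<delta>_def by (metis nat_approx_posE zero_less_divide_iff zero_less_numeral zero_less_power)
    have "dist (x n) (x k) < e" if "n \<ge> N" "k \<ge> N" for n k
    proof -
      have "\<delta> n \<le> \<delta> N" "\<delta> k \<le> \<delta> N"
        using that by (simp_all add: \<delta>_def frac_le)
      then have "2 * (J (x n) - m) + 2 * (J (x k) - m) < 4 * \<delta> N"
        using x[of n] x[of k] by simp
      with dist_le[of "x n" "x k"] N have "(norm (x n - x k))\<^sup>2 < e\<^sup>2"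
        by simp
      then show ?thesis
        using \<open>e > 0\<close> by (simp add: dist_norm power2_less_imp_less)
    qed
    then show "\<exists>M. \<forall>n\<ge>M. \<forall>k\<ge>M. dist (x n) (x k) < e" by blast
  qed
  then obtain g where g: "x \<longlonglongrightarrow> g"
    using Cauchy_convergent_iff convergent_def by blast
  have "(\<lambda>n. J (x n)) \<longlonglongrightarrow> J g"
    unfolding J_def
    by (intro tendsto_intros g tendsto_Re bounded_linear.tendsto[OF bounded_linear_to_complex])
  moreover have "(\<lambda>n. m + \<delta> n) \<longlonglongrightarrow> m + 0"
    unfolding \<delta>_def by (intro tendsto_intros LIMSEQ_Suc lim_1_over_n)
  ultimately have Jg: "J g \<le> m"
    using x by (intro LIMSEQ_le[of "\<lambda>n. J (x n)" _ "\<lambda>n. m + \<delta> n"]) (auto intro: less_imp_le)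
  have Re_eq: "Re (to_complex (ip g v - blinfun_apply L v)) = 0" for v
  proof -
    define s where "s = Re (to_complex (ip g v - blinfun_apply L v))"
    have J_line: "J (g + t *\<^sub>R v) = J g + 2 * t * s + t\<^sup>2 * (norm v)\<^sup>2" for t
      by (simp add: J_def norm_add_scaleR blinfun.add_right blinfun.scaleR_right to_complex_add
          to_complex_scaleR to_complex_diff s_def algebra_simps)
    \<comment> \<open>the minimiser of \<open>2 t s + t\<^sup>2 (1 + \<parallel>v\<parallel>\<^sup>2)\<close>, where the summand \<open>1\<close> covers the case \<open>v = 0\<close>\<close>
    define t where "t = - s / (1 + (norm v)\<^sup>2)"
    have pos: "1 + (norm v)\<^sup>2 > 0"
      by (simp add: add_pos_nonneg)
    have "0 \<le> 2 * t * s + t\<^sup>2 * (norm v)\<^sup>2"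
      using J_line[of t] m_le[of "g + t *\<^sub>R v"] Jg by simp
    also have "\<dots> \<le> 2 * t * s + t\<^sup>2 * (1 + (norm v)\<^sup>2)"
      by (simp add: algebra_simps)
    also have "\<dots> = - (s\<^sup>2 / (1 + (norm v)\<^sup>2))"
      using pos by (simp add: t_def power2_eq_square divide_simps)
    finally show ?thesis
      using pos by (simp add: s_def[symmetric] divide_le_0_iff)
  qed
  have "ip g v = blinfun_apply L v" for v
  proof -
    define c where "c = ip g v - blinfun_apply L v"
    have "ip g (scl b v) - blinfun_apply L (scl b v) = conjugate b * (ip g v - blinfun_apply L v)" for b
      using L by (simp add: antidual_def ip_scale_right right_diff_distrib)
    from this[of c] have "ip g (scl c v) - blinfun_apply L (scl c v) = c * conjugate c"
      by (simp add: c_def mult.commute)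
    with Re_eq[of "scl c v"] have "(norm c)\<^sup>2 = 0"
      by (simp only: mult_conjugate to_complex_of_real Re_complex_of_real)
    then have "c = 0" by simp
    then show ?thesis by (simp add: c_def)
  qed
  then have "L = represent g"
    by (intro blinfun_eqI) simp
  then show ?thesis by (rule that)
qed

section \<open>Orthonormal sets and finite rank operators\<close>

definition orthonormal :: "'v set \<Rightarrow> bool"
  where "orthonormal E \<longleftrightarrow>
    finite E \<and> (\<forall>e\<in>E. norm e = 1) \<and> (\<forall>e\<in>E. \<forall>e'\<in>E. e \<noteq> e' \<longrightarrow> ip e e' = 0)"

definition proj :: "'v set \<Rightarrow> 'v \<Rightarrow> 'v"
  where "proj E u = (\<Sum>e\<in>E. scl (ip u e) e)"

lemma ip_proj:
  assumes E: "orthonormal E" and "e \<in> E"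
  shows "ip (proj E u) e = ip u e"
proof -
  have "ip (proj E u) e = (\<Sum>e'\<in>E. if e' = e then ip u e else 0)"
    unfolding proj_def ip_sum_left
    using assms by (intro sum.cong) (auto simp: ip_scale_left orthonormal_def ip_self_eq_1)
  then show ?thesis
    using assms by (simp add: orthonormal_def)
qed

lemma ip_residual:
  assumes "orthonormal E" "e \<in> E"
  shows "ip (u - proj E u) e = 0"
  using assms by (simp add: ip_diff_left ip_proj)

lemma proj_orthogonal:
  assumes "\<forall>e\<in>E. ip w e = 0"
  shows "ip (proj E u) w = 0"
  unfolding proj_def ip_sum_left
  using assms by (intro sum.neutral) (simp add: ip_scale_left ip_eq_0_commute[of _ w])

lemma proj_basis: "orthonormal E \<Longrightarrow> e \<in> E \<Longrightarrow> proj E e = e"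
proof -
  assume E: "orthonormal E" "e \<in> E"
  have "proj E e = (\<Sum>e'\<in>E. if e' = e then e else 0)"
    unfolding proj_def
    using E by (intro sum.cong) (auto simp: orthonormal_def ip_self_eq_1)
  then show ?thesis using E by (simp add: orthonormal_def)
qed

lemma proj_add: "proj E (u + v) = proj E u + proj E v"
  by (simp add: proj_def ip_add_left scale_left_distrib sum.distrib)

lemma proj_scale: "proj E (scl c u) = scl c (proj E u)"
  by (simp add: proj_def ip_scale_left scale_sum_right)

text \<open>The condition \<open>proj E d = d\<close> expresses that \<open>d\<close> lies in the span of \<open>E\<close>. Since it is an explicit
expansion, no linear independence has to be tracked: a new vector that is already in the span adds
nothing.\<close>

lemma gram_schmidt:
  assumes "finite D"
  obtains E where "orthonormal E" "\<forall>d\<in>D. proj E d = d"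
proof -
  have "\<exists>E. orthonormal E \<and> (\<forall>d\<in>D. proj E d = d)"
    using assms
  proof (induction D)
    case empty
    show ?case by (rule exI[of _ "{}"]) (simp add: orthonormal_def)
  next
    case (insert d D)
    then obtain E where E: "orthonormal E" and D: "\<forall>x\<in>D. proj E x = x" by blast
    define r where "r = d - proj E d"
    show ?case
    proof (cases "r = 0")
      case True
      then show ?thesis using E D by (auto simp: r_def)
    next
      case False
      define k where "k = 1 / norm r"
      define e where "e = scl (of_real k) r"
      have k: "k * norm r = 1"
        using False by (simp add: k_def)
      moreover have "k > 0"
        using False by (simp add: k_def)
      ultimately have e_norm: "norm e = 1"
        by (simp add: e_def norm_scale)
      have r_orth: "ip r x = 0" if "x \<in> E" for x
        using E that by (simp add: r_def ip_residual)
      then have e_orth: "ip e x = 0" if "x \<in> E" for x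
        using that by (simp add: e_def ip_scale_left)
      then have "e \<notin> E"
        using e_norm ip_self_eq_1[OF e_norm] by force
      have fin: "finite E" using E by (simp add: orthonormal_def)
      have proj_ins: "proj (insert e E) u = scl (ip u e) e + proj E u" for u
        using fin \<open>e \<notin> E\<close> by (simp add: proj_def)
      have "orthonormal (insert e E)"
        using E e_norm e_orth e_orth[unfolded ip_eq_0_commute[of e]]
        by (auto simp: orthonormal_def)
      moreover have "proj (insert e E) x = x" if "x \<in> D" for x
      proof -
        have "ip x e = 0"
          using proj_orthogonal[of E e x] e_orth D that by simp
        then show ?thesis using D that by (simp add: proj_ins)
      qed
      moreover have "proj (insert e E) d = d"
      proof -
        have "ip (proj E d) r = 0"
          using r_orth by (intro proj_orthogonal) simp
        then have "ip d r = ip r r"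
          by (simp add: r_def ip_diff_left ip_diff_right)
        then have "scl (ip d e) e = scl (of_real ((k * norm r)\<^sup>2)) r"
          by (simp add: e_def ip_scale_right ip_self power2_eq_square algebra_simps)
        then have "scl (ip d e) e = r"
          using k by simp
        then show ?thesis by (simp add: proj_ins r_def)
      qed
      ultimately show ?thesis by blast
    qed
  qed
  then show ?thesis using that by blast
qed

text \<open>Represent the generators of the range by vectors and orthonormalise these. The coordinates of a
functional \<open>L\<close> in the range are then its values \<open>L e\<close> on the orthonormal vectors, so they are
controlled by the norm of \<open>L\<close>.\<close>

lemma finite_rank_expansion:
  assumes K: "K \<in> operators scl" "finite_rank K"
  obtains E where "orthonormal E"
    "\<And>u. blinfun_apply K u = (\<Sum>e\<in>E. dual_scale (blinfun_apply (blinfun_apply K u) e) (represent e))"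
proof -
  obtain F where F: "finite F" and range_K: "range (blinfun_apply K) = dual.span F"
    using K(2) by (auto simp: finite_rank_def)
  have "F \<subseteq> antidual scl"
    using K(1) dual.span_superset[of F] range_K by (auto simp: operators_def)
  then have "\<forall>f\<in>F. \<exists>g. f = represent g"
    by (meson riesz_representation subsetD)
  then obtain r where r: "\<And>f. f \<in> F \<Longrightarrow> f = represent (r f)"
    by metis
  obtain E where E: "orthonormal E" and proj_r: "\<forall>g\<in>r ` F. proj E g = g"
    using gram_schmidt[of "r ` F"] F by blast
  let ?S = "{L. L = (\<Sum>e\<in>E. dual_scale (blinfun_apply L e) (represent e))}"
  have "f \<in> ?S" if "f \<in> F" for f
  proof -
    have "blinfun_apply f v = blinfun_apply (\<Sum>e\<in>E. dual_scale (blinfun_apply f e) (represent e)) v" for v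
    proof -
      have "blinfun_apply f v = ip (proj E (r f)) v"
        using r[OF that] proj_r that by (metis image_eqI represent_apply)
      also have "\<dots> = (\<Sum>e\<in>E. blinfun_apply f e * ip e v)"
        using r[OF that] unfolding proj_def ip_sum_left ip_scale_left
        by (metis represent_apply)
      finally show ?thesis
        by (simp add: blinfun.sum_left)
    qed
    then have "f = (\<Sum>e\<in>E. dual_scale (blinfun_apply f e) (represent e))"
      by (rule blinfun_eqI)
    then show ?thesis by simp
  qed
  \<comment> \<open>the expansion is linear in the functional, so it extends from generators to their span\<close>
  moreover have "dual.subspace ?S"
    by (rule dual.subspaceI)
       (simp_all add: blinfun.add_left dual.scale_left_distrib sum.distrib
         flip: dual.scale_sum_right dual.scale_scale)
  ultimately have "dual.span F \<subseteq> ?S"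
    by (intro dual.span_minimal) blast+
  then show ?thesis
    using E range_K that by blast
qed

lemma norm_dual_scale_le: "norm (dual_scale c L) \<le> norm c * norm L"
  by (rule norm_blinfun_bound) (simp_all add: norm_mult mult.assoc mult_left_mono norm_blinfun)

lemma bounded_linear_dual_scale: "bounded_linear (\<lambda>c. dual_scale c L)"
proof (rule bounded_linear_intro[where K = "norm L"])
  show "dual_scale (r *\<^sub>R c) L = r *\<^sub>R dual_scale c L" for r c
    by (rule blinfun_eqI) (simp add: blinfun.scaleR_left)
qed (simp_all add: dual.scale_left_distrib norm_dual_scale_le)

lemma compact_bounded_combinations:
  assumes "finite I"
  shows "compact {\<Sum>i\<in>I. dual_scale (c i) (f i) | c. \<forall>i\<in>I. norm (c i) \<le> M}"
  using assms
proof (induction I)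
  case empty
  then show ?case by simp
next
  case (insert j I)
  let ?C = "\<lambda>I. {\<Sum>i\<in>I. dual_scale (c i) (f i) | c. \<forall>i\<in>I. norm (c i) \<le> M}"
  let ?B = "(\<lambda>c. dual_scale c (f j)) ` cball 0 M"
  have "compact ?B"
    by (intro compact_continuous_image compact_cball_scalar
        linear_continuous_on bounded_linear_dual_scale)
  then have "compact {x + y | x y. x \<in> ?B \<and> y \<in> ?C I}"
    using insert.IH by (rule compact_sums)
  moreover have "{x + y | x y. x \<in> ?B \<and> y \<in> ?C I} = ?C (insert j I)"
  proof (intro equalityI subsetI)
    fix z assume "z \<in> {x + y | x y. x \<in> ?B \<and> y \<in> ?C I}"
    then obtain b c where z: "z = dual_scale b (f j) + (\<Sum>i\<in>I. dual_scale (c i) (f i))"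
      and bc: "norm b \<le> M" "\<forall>i\<in>I. norm (c i) \<le> M"
      by auto
    have "(\<Sum>i\<in>I. dual_scale ((c(j := b)) i) (f i)) = (\<Sum>i\<in>I. dual_scale (c i) (f i))"
      using insert.hyps by (intro sum.cong) auto
    then have "z = (\<Sum>i\<in>insert j I. dual_scale ((c(j := b)) i) (f i))"
      using insert.hyps z by simp
    moreover have "\<forall>i\<in>insert j I. norm ((c(j := b)) i) \<le> M"
      using bc by simp
    ultimately show "z \<in> ?C (insert j I)" by blast
  next
    fix z assume "z \<in> ?C (insert j I)"
    then obtain c where "z = dual_scale (c j) (f j) + (\<Sum>i\<in>I. dual_scale (c i) (f i))"
      and "norm (c j) \<le> M" "\<forall>i\<in>I. norm (c i) \<le> M"
      using insert.hyps by auto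
    then show "z \<in> {x + y | x y. x \<in> ?B \<and> y \<in> ?C I}"
      by (auto intro!: exI image_eqI)
  qed
  ultimately show ?case by simp
qed

lemma finite_rank_imp_compact_operator:
  assumes "K \<in> operators scl" "finite_rank K"
  shows "compact_operator K"
  unfolding compact_operator_def
proof (intro allI impI)
  fix S :: "'v set" assume "bounded S"
  then obtain B where B: "\<And>u. u \<in> S \<Longrightarrow> norm u \<le> B"
    by (auto simp: bounded_iff)
  obtain E where E: "orthonormal E"
    and K: "\<And>u. blinfun_apply K u = (\<Sum>e\<in>E. dual_scale (blinfun_apply (blinfun_apply K u) e) (represent e))"
    using finite_rank_expansion[OF assms] by blast
  let ?C = "{\<Sum>e\<in>E. dual_scale (c e) (represent e) | c. \<forall>e\<in>E. norm (c e) \<le> norm K * B}"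
  have "compact ?C"
    using E by (intro compact_bounded_combinations) (simp add: orthonormal_def)
  moreover have "blinfun_apply K ` S \<subseteq> ?C"
  proof (intro subsetI, elim imageE)
    fix L u assume L: "L = blinfun_apply K u" and "u \<in> S"
    have "norm (blinfun_apply L e) \<le> norm K * B" if "e \<in> E" for e
    proof -
      have "norm (blinfun_apply L e) \<le> norm L"
        using norm_blinfun[of L e] E that by (simp add: orthonormal_def)
      also have "\<dots> \<le> norm K * norm u"
        unfolding L by (rule norm_blinfun)
      also have "\<dots> \<le> norm K * B"
        using B[OF \<open>u \<in> S\<close>] by (simp add: mult_left_mono)
      finally show ?thesis .
    qed
    then show "L \<in> ?C"
      using K[of u] L by blast
  qed
  ultimately have "closure (blinfun_apply K ` S) \<subseteq> ?C"
    by (intro closure_minimal compact_imp_closed)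
  then show "compact (closure (blinfun_apply K ` S))"
    using compact_Int_closed[OF \<open>compact ?C\<close>, of "closure (blinfun_apply K ` S)"]
    by (simp add: Int_absorb1)
qed

section \<open>Compact perturbations of coercive operators\<close>

lemma null_comparison:
  fixes f :: "nat \<Rightarrow> 'a::real_normed_vector"
  assumes "\<And>n. norm (f n) \<le> g n" "g \<longlonglongrightarrow> 0"
  shows "f \<longlonglongrightarrow> 0"
  using assms by (intro Lim_null_comparison[of f g]) auto

lemma operators_apply_scale_left:
  assumes "K \<in> operators scl"
  shows "blinfun_apply (blinfun_apply K (scl c u)) v = c * blinfun_apply (blinfun_apply K u) v"
proof -
  interpret K: Vector_Spaces.linear scl dual_scale "blinfun_apply K"
    using assms by (simp add: operators_def)
  show ?thesis by (simp add: K.scale)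
qed

lemma operators_apply_scale_right:
  assumes "K \<in> operators scl"
  shows "blinfun_apply (blinfun_apply K u) (scl c v) = conjugate c * blinfun_apply (blinfun_apply K u) v"
  using assms by (auto simp: operators_def antidual_def)

text \<open>A limit \<open>y\<close> of a subsequence exists by compactness. It is zero because, for each \<open>x\<close>, the map
\<open>w \<mapsto> \<langle>K w, x\<rangle>\<close> becomes a continuous antilinear functional after conjugation, so weak convergence
of \<open>v\<close> makes \<open>\<langle>K v\<^sub>n, x\<rangle>\<close> tend to \<open>0\<close>.\<close>

lemma compact_operator_weak_to_strong:
  assumes K: "K \<in> operators scl" "compact_operator K"
    and v: "weakly_converges scl v 0" "\<And>n. norm (v n) \<le> 1"
  obtains s :: "nat \<Rightarrow> nat" where "strict_mono s" "(\<lambda>n. blinfun_apply K (v (s n))) \<longlonglongrightarrow> 0"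
proof -
  have "compact (closure (blinfun_apply K ` cball 0 1))"
    using K(2) by (simp add: compact_operator_def)
  moreover have "\<forall>n. blinfun_apply K (v n) \<in> closure (blinfun_apply K ` cball 0 1)"
    using v(2) closure_subset by fastforce
  ultimately obtain y s where s: "strict_mono s"
    and y: "((\<lambda>n. blinfun_apply K (v n)) \<circ> s) \<longlonglongrightarrow> y"
    unfolding compact_def by metis
  have "blinfun_apply y x = 0" for x
  proof -
    let ?L = "Blinfun (\<lambda>w. conjugate (blinfun_apply (blinfun_apply K w) x))"
    have "bounded_linear (\<lambda>w. conjugate (blinfun_apply (blinfun_apply K w) x))"
      by (intro bounded_linear_compose[OF bounded_linear_conjugate]
          bounded_linear_compose[OF blinfun.bounded_linear_left] blinfun.bounded_linear_right)
    then have L: "blinfun_apply ?L w = conjugate (blinfun_apply (blinfun_apply K w) x)" for w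
      by (simp add: bounded_linear_Blinfun_apply)
    then have "?L \<in> antidual scl"
      using K(1) by (simp add: antidual_def operators_apply_scale_left conjugate_mult)
    then have "(\<lambda>n. pairing ?L (v n)) \<longlonglongrightarrow> pairing ?L 0"
      using v(1) unfolding weakly_converges_def by blast
    then have "(\<lambda>n. conjugate (blinfun_apply (blinfun_apply K (v n)) x)) \<longlonglongrightarrow> 0"
      by (simp add: pairing_def L blinfun.zero_right blinfun.zero_left)
    from tendsto_norm_zero[OF this, unfolded norm_conjugate]
    have "(\<lambda>n. blinfun_apply (blinfun_apply K (v n)) x) \<longlonglongrightarrow> 0"
      by (rule tendsto_norm_zero_cancel)
    from LIMSEQ_subseq_LIMSEQ[OF this s]
    have "(\<lambda>n. blinfun_apply (blinfun_apply K (v (s n))) x) \<longlonglongrightarrow> 0"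
      by (simp only: o_def)
    moreover have "(\<lambda>n. blinfun_apply (blinfun_apply K (v (s n))) x) \<longlonglongrightarrow> blinfun_apply y x"
      using blinfun.tendsto[OF y tendsto_const] by (simp add: o_def)
    ultimately show ?thesis
      by (metis LIMSEQ_unique)
  qed
  then have "y = 0" by (intro blinfun_eqI) simp
  with s y show ?thesis by (intro that) (simp_all add: o_def)
qed

text \<open>Dividing by norms that stay above some \<open>\<epsilon> > 0\<close> preserves both weak convergence and
\<open>\<langle>A u\<^sub>n, u\<^sub>n\<rangle> \<longlonglongrightarrow> 0\<close>. On unit vectors, coercivity of
\<open>A + K\<close> is a fixed positive lower bound.\<close>

theorem compact_perturbation_imp_essentially_coercive:
  assumes A: "A \<in> operators scl" and K: "K \<in> operators scl" "compact_operator K"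
    and "coercive (A + K)"
  shows "essentially_coercive scl A"
  unfolding essentially_coercive_def
proof (intro allI impI, rule ccontr)
  fix u
  assume u_weak: "weakly_converges scl u 0"
    and Au: "(\<lambda>n. pairing (blinfun_apply A (u n)) (u n)) \<longlonglongrightarrow> 0"
    and not_null: "\<not> (\<lambda>n. norm (u n)) \<longlonglongrightarrow> 0"
  obtain \<alpha> where \<alpha>: "\<alpha> > 0" "\<And>w. \<alpha> * (norm w)\<^sup>2 \<le> norm (pairing (blinfun_apply (A + K) w) w)"
    using assms(4) by (auto simp: coercive_def)
  obtain \<epsilon> where \<epsilon>: "\<epsilon> > 0" "infinite {n. \<epsilon> \<le> norm (u n)}"
    using not_null by (auto simp: LIMSEQ_iff infinite_nat_iff_unbounded_le not_less)
  obtain r :: "nat \<Rightarrow> nat" where r: "strict_mono r" "\<And>n. \<epsilon> \<le> norm (u (r n))"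
    using infinite_enumerate[OF \<epsilon>(2)] by auto
  define v where "v n = (1 / norm (u (r n))) *\<^sub>R u (r n)" for n
  have u_pos: "norm (u (r n)) > 0" for n
    using \<epsilon>(1) r(2)[of n] by linarith
  have norm_v: "norm (v n) = 1" for n
    using u_pos[of n] by (simp add: v_def)
  have v_weak: "weakly_converges scl v 0"
    unfolding weakly_converges_def
  proof
    fix L assume L: "L \<in> antidual scl"
    have "norm (pairing L (v n)) \<le> norm (pairing L (u (r n))) / \<epsilon>" for n
      using r(2)[of n] \<epsilon>(1) u_pos[of n]
      by (simp add: v_def pairing_def blinfun.scaleR_right frac_le)
    moreover have "(\<lambda>n. norm (pairing L (u (r n))) / \<epsilon>) \<longlonglongrightarrow> 0"
    proof -
      have "(\<lambda>n. pairing L (u n)) \<longlonglongrightarrow> 0"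
        using u_weak L by (auto simp: weakly_converges_def pairing_def blinfun.zero_right)
      from LIMSEQ_subseq_LIMSEQ[OF this r(1)] show ?thesis
        by (intro tendsto_divide_zero tendsto_norm_zero) (simp add: o_def)
    qed
    ultimately have "(\<lambda>n. pairing L (v n)) \<longlonglongrightarrow> 0"
      by (rule null_comparison)
    then show "(\<lambda>n. pairing L (v n)) \<longlonglongrightarrow> pairing L 0"
      by (simp add: pairing_def blinfun.zero_right)
  qed
  have "norm (pairing (blinfun_apply A (v n)) (v n))
      \<le> norm (pairing (blinfun_apply A (u (r n))) (u (r n))) / \<epsilon>\<^sup>2" for n
  proof -
    have "norm (pairing (blinfun_apply A (v n)) (v n))
        = norm (pairing (blinfun_apply A (u (r n))) (u (r n))) / (norm (u (r n)))\<^sup>2"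
      by (simp add: v_def pairing_def blinfun.scaleR_right blinfun.scaleR_left power2_eq_square)
    also have "\<dots> \<le> norm (pairing (blinfun_apply A (u (r n))) (u (r n))) / \<epsilon>\<^sup>2"
      using r(2)[of n] \<epsilon>(1) by (intro divide_left_mono power_mono mult_pos_pos zero_less_power u_pos) auto
    finally show ?thesis .
  qed
  moreover have "(\<lambda>n. norm (pairing (blinfun_apply A (u (r n))) (u (r n))) / \<epsilon>\<^sup>2) \<longlonglongrightarrow> 0"
    using LIMSEQ_subseq_LIMSEQ[OF Au r(1)]
    by (intro tendsto_divide_zero tendsto_norm_zero) (simp add: o_def)
  ultimately have Av: "(\<lambda>n. pairing (blinfun_apply A (v n)) (v n)) \<longlonglongrightarrow> 0"
    by (rule null_comparison)
  obtain s :: "nat \<Rightarrow> nat" where s: "strict_mono s"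
    and Kv: "(\<lambda>n. blinfun_apply K (v (s n))) \<longlonglongrightarrow> 0"
    using compact_operator_weak_to_strong[OF K v_weak] norm_v by auto
  have "norm (pairing (blinfun_apply K (v (s n))) (v (s n))) \<le> norm (blinfun_apply K (v (s n)))" for n
    using norm_blinfun[of "blinfun_apply K (v (s n))" "v (s n)"] by (simp add: norm_v pairing_def)
  then have "(\<lambda>n. pairing (blinfun_apply K (v (s n))) (v (s n))) \<longlonglongrightarrow> 0"
    by (rule null_comparison[OF _ tendsto_norm_zero[OF Kv]])
  then have "(\<lambda>n. pairing (blinfun_apply (A + K) (v (s n))) (v (s n))) \<longlonglongrightarrow> 0"
    using tendsto_add[OF LIMSEQ_subseq_LIMSEQ[OF Av s]]
    by (fastforce simp: o_def pairing_def blinfun.add_left)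
  then have "(\<lambda>n. norm (pairing (blinfun_apply (A + K) (v (s n))) (v (s n)))) \<longlonglongrightarrow> 0"
    by (rule tendsto_norm_zero)
  moreover have "\<alpha> \<le> norm (pairing (blinfun_apply (A + K) (v (s n))) (v (s n)))" for n
    using \<alpha>(2)[of "v (s n)"] by (simp add: norm_v)
  ultimately have "\<alpha> \<le> 0"
    by (intro LIMSEQ_le_const) auto
  then show False using \<alpha>(1) by simp
qed

section \<open>Coercivity on a subspace of finite codimension\<close>

text \<open>Every functional is \<open>\<langle>g, \<cdot>\<rangle>\<close>, and \<open>\<langle>g, u\<^sub>n\<rangle> = \<langle>g - d\<^sub>i, u\<^sub>n\<rangle>\<close> as soon as \<open>n > i\<close>.\<close>

lemma weakly_converges_of_eventually_orthogonal:
  assumes dense: "\<And>g \<epsilon>. \<epsilon> > 0 \<Longrightarrow> \<exists>i. norm (g - d i) < \<epsilon>"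
    and u: "\<And>n. norm (u n) = 1" "\<And>n i. i < n \<Longrightarrow> ip (u n) (d i) = 0"
  shows "weakly_converges scl u 0"
  unfolding weakly_converges_def
proof
  fix L assume "L \<in> antidual scl"
  then obtain g where L: "L = represent g"
    by (rule riesz_representation)
  have "(\<lambda>n. ip g (u n)) \<longlonglongrightarrow> 0"
  proof (rule LIMSEQ_I)
    fix \<epsilon> :: real assume "\<epsilon> > 0"
    then obtain i where i: "norm (g - d i) < \<epsilon>"
      using dense by blast
    have "norm (ip g (u n)) < \<epsilon>" if "n \<ge> Suc i" for n
    proof -
      have "ip (d i) (u n) = 0"
        using u(2)[of i n] that ip_eq_0_commute[of "d i" "u n"] by simp
      then have "norm (ip g (u n)) = norm (ip (g - d i) (u n))"
        by (simp add: ip_diff_left)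
      also have "\<dots> \<le> norm (g - d i)"
        using Cauchy_Schwarz[of "g - d i" "u n"] u(1) by simp
      finally show ?thesis using i by simp
    qed
    then show "\<exists>N. \<forall>n\<ge>N. norm (ip g (u n) - 0) < \<epsilon>" by auto
  qed
  then show "(\<lambda>n. pairing L (u n)) \<longlonglongrightarrow> pairing L 0"
    by (simp add: L pairing_def)
qed

text \<open>If coercivity failed on the orthogonal complement of the first \<open>n\<close> members of a dense sequence for
every \<open>n\<close>, the unit vectors that witness this would converge weakly to \<open>0\<close> and refute
essential coercivity.\<close>

lemma essentially_coercive_imp_coercive_finite_codim:
  assumes ess: "essentially_coercive scl A"
    and sep: "separable_space (euclidean :: 'v topology)"
  obtains D b where "finite D" "b > 0"
    "\<And>w. \<forall>d\<in>D. ip w d = 0 \<Longrightarrow> b * (norm w)\<^sup>2 \<le> norm (pairing (blinfun_apply A w) w)"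
proof (rule ccontr)
  assume no: "\<not> thesis"
  obtain C :: "'v set" where C: "countable C" "closure C = UNIV"
    using sep by (auto simp: separable_space_def euclidean_closure_of)
  then have "C \<noteq> {}" by auto
  define d where "d = from_nat_into C"
  have range_d: "range d = C"
    using C(1) \<open>C \<noteq> {}\<close> by (simp add: d_def)
  have dense: "\<exists>i. norm (g - d i) < \<epsilon>" if \<epsilon>: "\<epsilon> > 0" for g \<epsilon>
  proof -
    have "g \<in> closure C" using C(2) by simp
    then obtain y where "y \<in> C" "dist y g < \<epsilon>"
      using \<epsilon> unfolding closure_approachable by blast
    then show ?thesis
      using range_d by (auto simp: dist_norm norm_minus_commute)
  qed
  have "\<exists>u. norm u = 1 \<and> (\<forall>i<n. ip u (d i) = 0) \<and>
      norm (pairing (blinfun_apply A u) u) \<le> inverse (real (Suc n))" for n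
  proof -
    have "\<exists>w. (\<forall>x\<in>d ` {..<n}. ip w x = 0) \<and>
        norm (pairing (blinfun_apply A w) w) < inverse (real (Suc n)) * (norm w)\<^sup>2"
    proof (rule ccontr)
      assume "\<not> ?thesis"
      then have thesis
        by (intro that[of "d ` {..<n}" "inverse (real (Suc n))"]) (auto simp: not_less)
      with no show False ..
    qed
    then obtain w where w: "\<And>i. i < n \<Longrightarrow> ip w (d i) = 0"
      "norm (pairing (blinfun_apply A w) w) < inverse (real (Suc n)) * (norm w)\<^sup>2"
      by auto
    then have "w \<noteq> 0" by auto
    define u where "u = (1 / norm w) *\<^sub>R w"
    have "norm (pairing (blinfun_apply A u) u) = norm (pairing (blinfun_apply A w) w) / (norm w)\<^sup>2"
      by (simp add: u_def pairing_def blinfun.scaleR_right blinfun.scaleR_left power2_eq_square)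
    also have "\<dots> \<le> inverse (real (Suc n))"
      using w(2) \<open>w \<noteq> 0\<close> by (simp add: pos_divide_le_eq)
    finally show ?thesis
      using w(1) \<open>w \<noteq> 0\<close>
      by (intro exI[of _ u]) (simp add: u_def scaleR_eq_scale ip_scale_left norm_scale norm_divide)
  qed
  then obtain u where u: "\<And>n. norm (u n) = 1" "\<And>n i. i < n \<Longrightarrow> ip (u n) (d i) = 0"
    "\<And>n. norm (pairing (blinfun_apply A (u n)) (u n)) \<le> inverse (real (Suc n))"
    by metis
  have "weakly_converges scl u 0"
    using dense u(1,2) by (rule weakly_converges_of_eventually_orthogonal)
  moreover have "(\<lambda>n. pairing (blinfun_apply A (u n)) (u n)) \<longlonglongrightarrow> 0"
    using u(3) LIMSEQ_inverse_real_of_nat by (rule null_comparison)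
  ultimately have "(\<lambda>n. norm (u n)) \<longlonglongrightarrow> 0"
    using ess by (simp add: essentially_coercive_def)
  then show False
    by (simp add: u(1) LIMSEQ_const_iff)
qed

section \<open>The numerical range\<close>

definition sesquilinear :: "('v \<Rightarrow> 'v \<Rightarrow> 'k) \<Rightarrow> bool"
  where "sesquilinear a \<longleftrightarrow>
    (\<forall>x y z. a (x + y) z = a x z + a y z) \<and> (\<forall>x y z. a x (y + z) = a x y + a x z) \<and>
    (\<forall>c x y. a (scl c x) y = c * a x y) \<and> (\<forall>c x y. a x (scl c y) = conjugate c * a x y)"

lemma sesquilinear_normalize:
  assumes "sesquilinear a"
  shows "sesquilinear (\<lambda>x y. (a x y - p * ip x y) / q)"
proof -
  have "(u + v - p * (s + t)) / q = (u - p * s) / q + (v - p * t) / q" for u v s t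
    by (simp add: distrib_left add_diff_add flip: add_divide_distrib)
  moreover have "(c * u - p * (c * s)) / q = c * ((u - p * s) / q)" for c u s
    by (simp add: right_diff_distrib mult.left_commute)
  ultimately show ?thesis
    using assms unfolding sesquilinear_def ip_add_left ip_add_right ip_scale_left ip_scale_right
    by simp
qed

text \<open>By sesquilinearity the imaginary part of the sum is that of \<open>c (b x y - cnj (b y x))\<close>, which
a suitable phase \<open>c\<close> makes zero.\<close>

lemma cross_terms_real:
  assumes "sesquilinear b"
  obtains c s where "norm c = 1" "b (scl c x) y + b y (scl c x) = of_real s"
proof -
  obtain c where c: "norm c = 1"
    "c * (b x y - conjugate (b y x)) = of_real (norm (b x y - conjugate (b y x)))"
    by (rule phase)
  let ?t = "to_complex (b (scl c x) y + b y (scl c x))"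
  have "?t = to_complex c * to_complex (b x y) + cnj (to_complex c) * to_complex (b y x)"
    using assms by (simp add: sesquilinear_def to_complex_add to_complex_mult to_complex_conjugate)
  moreover have "to_complex c * (to_complex (b x y) - cnj (to_complex (b y x)))
      = of_real (norm (b x y - conjugate (b y x)))"
    using arg_cong[OF c(2), of to_complex]
    by (simp add: to_complex_mult to_complex_diff to_complex_conjugate)
  then have "Im (to_complex c * (to_complex (b x y) - cnj (to_complex (b y x)))) = 0"
    by simp
  ultimately have "Im ?t = 0"
    by (simp add: algebra_simps)
  then have "?t = to_complex (of_real (Re ?t) :: 'k)"
    by (simp add: complex_eq_iff)
  then have "b (scl c x) y + b y (scl c x) = of_real (Re ?t)"
    by (simp only: to_complex_eq_iff)
  with c(1) show ?thesis by (rule that)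
qed

text \<open>This is the heart of the convexity theorem, normalised so that the two given values are \<open>0\<close> and
\<open>1\<close>. Once the phase of \<open>x\<close> makes the cross terms real, the values of \<open>b\<close> along the segment from
\<open>x\<close> to \<open>y\<close> are real. After division by the squared norm they run continuously from \<open>0\<close> to
\<open>1\<close>, so every value in between is attained.\<close>

lemma numerical_range_segment:
  assumes b: "sesquilinear b" and W: "subspace W" "x \<in> W" "y \<in> W"
    and xy: "norm x = 1" "norm y = 1" "b x x = 0" "b y y = 1"
    and \<tau>: "0 \<le> \<tau>" "\<tau> \<le> (1 :: real)"
  obtains w where "w \<in> W" "norm w = 1" "b w w = of_real \<tau>"
proof -
  have b_simps: "b (x + y) z = b x z + b y z" "b x (y + z) = b x y + b x z"
    "b (scl c x) y = c * b x y" "b x (scl c y) = conjugate c * b x y" for x y z c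
    using b by (simp_all add: sesquilinear_def)
  obtain c s where c: "norm c = 1" and s: "b (scl c x) y + b y (scl c x) = of_real s"
    using b by (rule cross_terms_real)
  define z where "z t = (1 - t) *\<^sub>R scl c x + t *\<^sub>R y" for t
  have zz: "b (z t) (z t) = of_real (t * (1 - t) * s + t\<^sup>2)" for t
  proof -
    have "b (z t) (z t) = of_real (t * (1 - t)) * (b (scl c x) y + b y (scl c x)) + of_real (t\<^sup>2)"
      unfolding z_def scaleR_eq_scale
      by (simp only: b_simps xy conjugate_of_real) (simp add: algebra_simps power2_eq_square)
    then show ?thesis by (simp add: s)
  qed
  \<comment> \<open>\<open>x\<close> and \<open>y\<close> are linearly independent, because \<open>b\<close> vanishes on multiples of \<open>x\<close> but not at \<open>y\<close>\<close>
  have z_nonzero: "z t \<noteq> 0" for t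
  proof
    assume "z t = 0"
    then have zt: "scl (of_real (1 - t)) (scl c x) = scl (of_real (- t)) y"
      by (simp add: z_def scaleR_eq_scale eq_neg_iff_add_eq_0 scale_minus_left del: scale_scale)
    have "b (scl (of_real (1 - t)) (scl c x)) (scl (of_real (1 - t)) (scl c x)) = 0"
      by (simp only: b_simps xy mult_zero_right)
    then have "t = 0"
      unfolding zt by (simp only: b_simps xy conjugate_of_real) simp
    then show False
      using zt c xy(1) by auto
  qed
  define g where "g t = (t * (1 - t) * s + t\<^sup>2) / (norm (z t))\<^sup>2" for t
  have "continuous_on {0..1} z"
    unfolding z_def by (intro continuous_intros)
  then have "continuous_on {0..1} g"
    unfolding g_def by (intro continuous_intros) (simp_all add: z_nonzero)
  moreover have "g 0 = 0" "g 1 = 1"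
    using xy by (simp_all add: g_def z_def)
  ultimately obtain t where t: "g t = \<tau>"
    using IVT'[of g 0 \<tau> 1] \<tau> by auto
  define w where "w = (1 / norm (z t)) *\<^sub>R z t"
  have "w \<in> W"
    using W by (simp add: w_def z_def scaleR_eq_scale subspace_add subspace_scale)
  moreover have "norm w = 1"
    using z_nonzero[of t] by (simp add: w_def)
  moreover have "b w w = of_real (g t)"
  proof -
    have "b w w = of_real ((1 / norm (z t)) * ((1 / norm (z t)) * (t * (1 - t) * s + t\<^sup>2)))"
      unfolding w_def scaleR_eq_scale b_simps conjugate_of_real zz of_real_mult[symmetric] ..
    also have "(1 / norm (z t)) * ((1 / norm (z t)) * (t * (1 - t) * s + t\<^sup>2)) = g t"
      by (simp add: g_def power2_eq_square)
    finally show ?thesis .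
  qed
  ultimately show ?thesis
    using t by (intro that) simp_all
qed

definition numerical_range :: "('v \<Rightarrow> 'v \<Rightarrow> 'k) \<Rightarrow> 'v set \<Rightarrow> complex set"
  where "numerical_range a W = (\<lambda>w. to_complex (a w w)) ` {w \<in> W. norm w = 1}"

text \<open>Subtracting \<open>p \<langle>\<cdot>, \<cdot>\<rangle>\<close> and dividing by a scalar acts on the numerical range as an affine map. So
two distinct values can be moved to \<open>0\<close> and \<open>1\<close>.\<close>

theorem toeplitz_hausdorff:
  assumes a: "sesquilinear a" and W: "subspace W"
  shows "convex (numerical_range a W)"
  unfolding convex_alt
proof (intro ballI allI impI, elim conjE)
  fix P Q and \<tau> :: real
  assume "P \<in> numerical_range a W" "Q \<in> numerical_range a W" and \<tau>: "0 \<le> \<tau>" "\<tau> \<le> 1"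
  then obtain x y where x: "x \<in> W" "norm x = 1" "P = to_complex (a x x)"
    and y: "y \<in> W" "norm y = 1" "Q = to_complex (a y y)"
    by (auto simp: numerical_range_def)
  show "(1 - \<tau>) *\<^sub>R P + \<tau> *\<^sub>R Q \<in> numerical_range a W"
  proof (cases "a x x = a y y")
    case True
    then have "(1 - \<tau>) *\<^sub>R P + \<tau> *\<^sub>R Q = P"
      using x y by (simp flip: scaleR_left_distrib)
    then show ?thesis
      using x by (auto simp: numerical_range_def)
  next
    case False
    define q where "q = a y y - a x x"
    define b where "b u v = (a u v - a x x * ip u v) / q" for u v
    have b: "sesquilinear b"
      unfolding b_def using a by (rule sesquilinear_normalize)
    have "b x x = 0" "b y y = 1"
      using x y False by (simp_all add: b_def q_def ip_self_eq_1)
    then obtain w where w: "w \<in> W" "norm w = 1" "b w w = of_real \<tau>"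
      using numerical_range_segment[OF b W] x y \<tau> by metis
    have form: "a w w = a x x + q * of_real \<tau>"
      using w(2,3) False by (simp add: b_def q_def ip_self_eq_1 field_simps)
    have "to_complex (a w w) = (1 - \<tau>) *\<^sub>R P + \<tau> *\<^sub>R Q"
      by (simp add: form q_def x y to_complex_add to_complex_mult to_complex_diff scaleR_conv_of_real
          algebra_simps)
    then show ?thesis
      using w by (auto simp: numerical_range_def intro!: image_eqI[of _ _ w])
  qed
qed

text \<open>The numerical range is convex, and its closure avoids \<open>0\<close>. A separating line yields the half-plane,
and the factor \<open>d\<close> rotates this half-plane to the right.\<close>

lemma coercive_form_in_half_plane:
  assumes a: "sesquilinear a" and W: "subspace W"
    and \<alpha>: "\<alpha> > 0" "\<And>w. w \<in> W \<Longrightarrow> \<alpha> * (norm w)\<^sup>2 \<le> norm (a w w)"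
  obtains d \<beta> where "d \<noteq> 0" "\<beta> > 0" "\<And>w. w \<in> W \<Longrightarrow> \<beta> * (norm w)\<^sup>2 \<le> Re (to_complex (d * a w w))"
proof -
  have a_zero: "a 0 0 = 0"
    using a unfolding sesquilinear_def by (metis mult_zero_left scale_zero_left)
  have normalize: "a w w = of_real ((norm w)\<^sup>2) * a u u" "u \<in> W" "norm u = 1"
    if "w \<in> W" "w \<noteq> 0" "u = scl (of_real (1 / norm w)) w" for u w
  proof -
    have "a u u = of_real (1 / norm w) * (of_real (1 / norm w) * a w w)"
      using a by (simp only: that(3) sesquilinear_def conjugate_of_real)
    then show "a w w = of_real ((norm w)\<^sup>2) * a u u"
      using that(2) by (simp add: power2_eq_square)
    show "u \<in> W" using W that by (simp add: subspace_scale)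
    show "norm u = 1"
      using that(2) by (simp add: that(3) norm_scale norm_divide)
  qed
  show ?thesis
  proof (cases "numerical_range a W = {}")
    case True
    have "w = 0" if "w \<in> W" for w
      using normalize(2,3)[OF that] True by (auto simp: numerical_range_def)
    then have "1 * (norm w)\<^sup>2 \<le> Re (to_complex (1 * a w w))" if "w \<in> W" for w
      using a_zero that by fastforce
    then show ?thesis
      by (intro that[of 1 1]) simp_all
  next
    case False
    have "\<alpha> \<le> norm z" if "z \<in> numerical_range a W" for z
      using that \<alpha>(2) by (force simp: numerical_range_def norm_to_complex)
    then have "closure (numerical_range a W) \<subseteq> {z. \<alpha> \<le> norm z}"
      by (intro closure_minimal closed_Collect_le continuous_intros) auto
    then have "0 \<notin> closure (numerical_range a W)"
      using \<alpha>(1) by auto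
    then obtain h \<beta> where \<beta>: "\<beta> > 0" "\<forall>z\<in>closure (numerical_range a W). \<beta> < inner h z"
      using separating_hyperplane_closed_0[OF convex_closure[OF toeplitz_hausdorff[OF a W]]]
      by auto
    obtain d :: 'k where d: "\<And>k. Re (to_complex (d * k)) = inner h (to_complex k)"
      using real_functional by blast
    have unit: "\<beta> < Re (to_complex (d * a u u))" if "u \<in> W" "norm u = 1" for u
      using \<beta>(2) closure_subset[of "numerical_range a W"] that
      by (auto simp: d numerical_range_def)
    have "d \<noteq> 0"
      using False \<beta>(1) unit by (fastforce simp: numerical_range_def)
    moreover have "\<beta> * (norm w)\<^sup>2 \<le> Re (to_complex (d * a w w))" if "w \<in> W" for w
    proof (cases "w = 0")
      case True
      with a_zero show ?thesis by simp
    next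
      case False
      define u where "u = scl (of_real (1 / norm w)) w"
      note n = normalize[OF \<open>w \<in> W\<close> False u_def]
      have "Re (to_complex (d * a w w)) = (norm w)\<^sup>2 * Re (to_complex (d * a u u))"
        by (subst n(1)) (simp add: to_complex_mult to_complex_power algebra_simps flip: of_real_power)
      also have "\<dots> \<ge> (norm w)\<^sup>2 * \<beta>"
        using unit[OF n(2,3)] by (intro mult_left_mono) auto
      finally show ?thesis by (simp add: mult.commute)
    qed
    ultimately show ?thesis
      using \<beta>(1) by (intro that)
  qed
qed

section \<open>A finite rank correction\<close>

definition projection_operator :: "'v set \<Rightarrow> 'k \<Rightarrow> 'v \<Rightarrow>\<^sub>L ('v \<Rightarrow>\<^sub>L 'k)"
  where "projection_operator E c = Blinfun (\<lambda>u. dual_scale c (represent (proj E u)))"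

lemma residual_orthogonal_proj:
  assumes "orthonormal E"
  shows "ip (u - proj E u) (proj E u) = 0"
proof -
  have "ip (proj E u) (u - proj E u) = 0"
    using ip_residual[OF assms] by (intro proj_orthogonal ballI)
  then show ?thesis
    by (subst ip_eq_0_commute)
qed

lemma norm_proj_pythagoras:
  assumes "orthonormal E"
  shows "(norm u)\<^sup>2 = (norm (u - proj E u))\<^sup>2 + (norm (proj E u))\<^sup>2"
  using pythagoras[OF residual_orthogonal_proj[OF assms], of u] by simp

lemma norm_proj_le:
  assumes "orthonormal E"
  shows "norm (proj E u) \<le> norm u"
  by (rule power2_le_imp_le) (simp_all add: norm_proj_pythagoras[OF assms, of u])

lemma norm_represent_le: "norm (represent g) \<le> norm g"
  by (rule norm_blinfun_bound) (simp_all add: Cauchy_Schwarz)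

lemma represent_add: "represent (g + h) = represent g + represent h"
  by (rule blinfun_eqI) (simp add: blinfun.add_left ip_add_left)

lemma represent_scale: "represent (scl c g) = dual_scale c (represent g)"
  by (rule blinfun_eqI) (simp add: ip_scale_left)

lemma projection_operator_apply:
  assumes "orthonormal E"
  shows "blinfun_apply (projection_operator E c) u = dual_scale c (represent (proj E u))"
proof -
  have "bounded_linear (\<lambda>u. dual_scale c (represent (proj E u)))"
  proof (rule bounded_linear_intro[where K = "norm c"])
    show "dual_scale c (represent (proj E (r *\<^sub>R u))) = r *\<^sub>R dual_scale c (represent (proj E u))" for r u
      by (rule blinfun_eqI)
         (simp add: scaleR_eq_scale proj_scale ip_scale_left blinfun.scaleR_left scaleR_conv_of_real)
    show "norm (dual_scale c (represent (proj E u))) \<le> norm u * norm c" for u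
    proof -
      have "norm (dual_scale c (represent (proj E u))) \<le> norm c * norm (represent (proj E u))"
        by (rule norm_dual_scale_le)
      also have "\<dots> \<le> norm c * norm u"
        using norm_represent_le[of "proj E u"] norm_proj_le[OF assms, of u]
        by (intro mult_left_mono) auto
      finally show ?thesis by (simp add: mult.commute)
    qed
  qed (simp add: proj_add represent_add dual.scale_right_distrib)
  then show ?thesis
    by (simp add: projection_operator_def bounded_linear_Blinfun_apply)
qed

lemma projection_operator_in_operators:
  assumes "orthonormal E"
  shows "projection_operator E c \<in> operators scl"
proof -
  have "Vector_Spaces.linear scl dual_scale (blinfun_apply (projection_operator E c))"
  proof (intro Vector_Spaces.linear_iff[THEN iffD2] conjI allI)
    show "vector_space scl" "vector_space dual_scale"
      by (rule vector_space_axioms dual.vector_space_axioms)+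
    show "blinfun_apply (projection_operator E c) (u + v)
        = blinfun_apply (projection_operator E c) u + blinfun_apply (projection_operator E c) v" for u v
      by (rule blinfun.add_right)
    show "blinfun_apply (projection_operator E c) (scl k u)
        = dual_scale k (blinfun_apply (projection_operator E c) u)" for k u
      by (rule blinfun_eqI)
         (simp add: projection_operator_apply[OF assms] proj_scale ip_scale_left mult.left_commute)
  qed
  moreover have "range (blinfun_apply (projection_operator E c)) \<subseteq> antidual scl"
    by (auto simp: projection_operator_apply[OF assms] antidual_def ip_scale_right)
  ultimately show ?thesis
    by (simp add: operators_def)
qed

lemma projection_operator_finite_rank:
  assumes E: "orthonormal E" and "c \<noteq> 0"
  shows "finite_rank (projection_operator E c)"
  unfolding finite_rank_def
proof (intro exI conjI equalityI)
  let ?K = "projection_operator E c"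
  interpret K: Vector_Spaces.linear scl dual_scale "blinfun_apply ?K"
    using projection_operator_in_operators[OF E, of c] by (simp add: operators_def)
  show "finite (represent ` E)"
    using E by (simp add: orthonormal_def)
  show "range (blinfun_apply ?K) \<subseteq> dual.span (represent ` E)"
  proof
    fix L assume "L \<in> range (blinfun_apply ?K)"
    then obtain u where "L = dual_scale c (represent (proj E u))"
      by (auto simp: projection_operator_apply[OF E])
    also have "represent (proj E u) = (\<Sum>e\<in>E. dual_scale (ip u e) (represent e))"
      by (rule blinfun_eqI) (simp add: proj_def blinfun.sum_left ip_sum_left ip_scale_left)
    finally show "L \<in> dual.span (represent ` E)"
      by (auto intro!: dual.span_scale dual.span_sum intro: dual.span_base)
  qed
  have "represent e \<in> range (blinfun_apply ?K)" if "e \<in> E" for e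
  proof (rule range_eqI)
    show "represent e = blinfun_apply ?K (scl (1 / c) e)"
      using E \<open>c \<noteq> 0\<close> that
      by (simp add: projection_operator_apply proj_scale proj_basis represent_scale)
  qed
  moreover have "dual.subspace (range (blinfun_apply ?K))"
    by (rule K.subspace_image[OF subspace_UNIV])
  ultimately show "dual.span (represent ` E) \<subseteq> range (blinfun_apply ?K)"
    by (intro dual.span_minimal) auto
qed

text \<open>Write \<open>u = w + f\<close> with \<open>f = P u\<close> in the span of \<open>E\<close> and \<open>w\<close> orthogonal to it. The real part of
\<open>d \<langle>A u, u\<rangle>\<close> is at least \<open>\<beta> \<parallel>w\<parallel>\<^sup>2 - 2 M \<parallel>w\<parallel> \<parallel>f\<parallel> - M \<parallel>f\<parallel>\<^sup>2\<close>, and a large multiple of \<open>\<parallel>f\<parallel>\<^sup>2\<close>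
outweighs the negative terms.\<close>

theorem finite_codim_coercive_imp_finite_rank_perturbation:
  assumes A: "A \<in> operators scl" and E: "orthonormal E" and b: "b > 0"
    and coer: "\<And>w. \<forall>e\<in>E. ip w e = 0 \<Longrightarrow> b * (norm w)\<^sup>2 \<le> norm (pairing (blinfun_apply A w) w)"
  shows "\<exists>K\<in>operators scl. finite_rank K \<and> coercive (A + K)"
proof -
  define a where "a u v = pairing (blinfun_apply A u) v" for u v
  have a: "sesquilinear a"
    unfolding sesquilinear_def a_def pairing_def
    by (intro conjI allI) (simp_all only: blinfun.add_left blinfun.add_right
        operators_apply_scale_left[OF A] operators_apply_scale_right[OF A])
  let ?W = "{w. \<forall>e\<in>E. ip w e = 0}"
  have W: "subspace ?W"
    by (rule subspaceI) (simp_all add: ip_add_left ip_scale_left)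
  obtain d \<beta> where d: "d \<noteq> 0" and \<beta>: "\<beta> > 0"
    and half: "\<And>w. w \<in> ?W \<Longrightarrow> \<beta> * (norm w)\<^sup>2 \<le> Re (to_complex (d * a w w))"
    using coercive_form_in_half_plane[OF a W b] coer by (auto simp: a_def)
  define M where "M = norm d * norm A"
  have M: "- (M * norm u * norm v) \<le> Re (to_complex (d * a u v))" for u v
  proof -
    have "norm (a u v) \<le> norm (blinfun_apply A u) * norm v"
      unfolding a_def pairing_def by (rule norm_blinfun)
    also have "\<dots> \<le> norm A * norm u * norm v"
      by (intro mult_right_mono norm_blinfun) simp
    finally have "norm (d * a u v) \<le> M * norm u * norm v"
      by (simp add: M_def norm_mult mult.assoc mult_left_mono)
    then show ?thesis
      using Re_ge_neg_norm[of "d * a u v"] by linarith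
  qed
  have "M \<ge> 0" by (simp add: M_def)
  \<comment> \<open>\<open>2 M\<^sup>2 / \<beta>\<close> comes from Young's inequality for the mixed terms, \<open>M\<close> compensates \<open>d \<langle>A f, f\<rangle>\<close>, and \<open>\<beta> / 2\<close> is the coercivity gained on \<open>f\<close>\<close>
  define l where "l = 2 * M\<^sup>2 / \<beta> + M + \<beta> / 2"
  have "l > 0"
    using \<beta> \<open>M \<ge> 0\<close> by (simp add: l_def add_nonneg_pos)
  \<comment> \<open>dividing by \<open>d\<close> makes the correction positive after the rotation by \<open>d\<close>\<close>
  define K where "K = projection_operator E (of_real l / d)"
  have K_form: "d * pairing (blinfun_apply K u) u = of_real (l * (norm (proj E u))\<^sup>2)" for u
  proof -
    have "ip (proj E u) u = ip (proj E u) (proj E u)"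
      using residual_orthogonal_proj[OF E, of u] ip_eq_0_commute[of "u - proj E u" "proj E u"]
      by (simp add: ip_diff_right)
    then show ?thesis
      using d by (simp add: K_def projection_operator_apply[OF E] pairing_def ip_self)
  qed
  have main: "\<beta> / 2 * (norm u)\<^sup>2 \<le> norm d * norm (pairing (blinfun_apply (A + K) u) u)" for u
  proof -
    define f where "f = proj E u"
    define w where "w = u - f"
    have u: "u = w + f" by (simp add: w_def)
    have "w \<in> ?W"
      using ip_residual[OF E, of _ u] by (simp add: w_def f_def)
    have form: "d * pairing (blinfun_apply (A + K) u) u
        = d * a w w + d * a w f + d * a f w + d * a f f + of_real (l * (norm f)\<^sup>2)"
    proof -
      have "d * pairing (blinfun_apply (A + K) u) u = d * a u u + of_real (l * (norm f)\<^sup>2)"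
        using K_form[of u]
        by (simp add: f_def a_def pairing_def blinfun.add_left distrib_left)
      also have "a u u = a w w + a w f + a f w + a f f"
        unfolding u using a by (simp add: sesquilinear_def)
      finally show ?thesis by (simp add: distrib_left)
    qed
    have young: "2 * M * norm w * norm f \<le> \<beta> / 2 * (norm w)\<^sup>2 + 2 * M\<^sup>2 / \<beta> * (norm f)\<^sup>2"
    proof -
      have "0 \<le> (\<beta> * norm w - 2 * M * norm f)\<^sup>2 / (2 * \<beta>)"
        using \<beta> by simp
      also have "\<dots> = \<beta> / 2 * (norm w)\<^sup>2 + 2 * M\<^sup>2 / \<beta> * (norm f)\<^sup>2 - 2 * M * norm w * norm f"
        using \<beta> by (simp add: power2_eq_square field_simps)
      finally show ?thesis by simp
    qed
    have l_f: "l * (norm f)\<^sup>2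
        = 2 * M\<^sup>2 / \<beta> * (norm f)\<^sup>2 + M * norm f * norm f + \<beta> / 2 * (norm f)\<^sup>2"
      by (simp add: l_def distrib_right power2_eq_square)
    have "(norm u)\<^sup>2 = (norm w)\<^sup>2 + (norm f)\<^sup>2"
      using norm_proj_pythagoras[OF E, of u] by (simp add: w_def f_def)
    then have "\<beta> / 2 * (norm u)\<^sup>2 = \<beta> / 2 * (norm w)\<^sup>2 + \<beta> / 2 * (norm f)\<^sup>2"
      by (simp add: distrib_left)
    also have "\<dots> \<le> \<beta> * (norm w)\<^sup>2 - M * norm w * norm f - M * norm f * norm w
        - M * norm f * norm f + l * (norm f)\<^sup>2"
      using young l_f by (simp add: mult.commute mult.left_commute)
    also have "\<dots> \<le> Re (to_complex (d * pairing (blinfun_apply (A + K) u) u))"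
      unfolding form to_complex_add to_complex_of_real plus_complex.sel Re_complex_of_real
      using half[OF \<open>w \<in> ?W\<close>] M[of w f] M[of f w] M[of f f] by linarith
    also have "\<dots> \<le> norm (d * pairing (blinfun_apply (A + K) u) u)"
      using complex_Re_le_cmod[of "to_complex (d * pairing (blinfun_apply (A + K) u) u)"]
      unfolding norm_to_complex .
    finally show ?thesis by (simp add: norm_mult)
  qed
  have "coercive (A + K)"
    unfolding coercive_def
  proof (intro exI conjI allI)
    show "\<beta> / (2 * norm d) > 0"
      using \<beta> d by simp
    show "\<beta> / (2 * norm d) * (norm u)\<^sup>2 \<le> norm (pairing (blinfun_apply (A + K) u) u)" for u
      using main[of u] d by (simp add: field_simps)
  qed
  moreover have "finite_rank K"
    unfolding K_def using \<open>l > 0\<close> d by (intro projection_operator_finite_rank[OF E]) simp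
  moreover have "K \<in> operators scl"
    unfolding K_def by (rule projection_operator_in_operators[OF E])
  ultimately show ?thesis by blast
qed

theorem essentially_coercive_imp_finite_rank_perturbation:
  assumes A: "A \<in> operators scl" and "essentially_coercive scl A"
    and "separable_space (euclidean :: 'v topology)"
  shows "\<exists>K\<in>operators scl. finite_rank K \<and> coercive (A + K)"
proof -
  obtain D b where D: "finite D" and b: "b > 0"
    and coer: "\<And>w. \<forall>d\<in>D. ip w d = 0 \<Longrightarrow> b * (norm w)\<^sup>2 \<le> norm (pairing (blinfun_apply A w) w)"
    using essentially_coercive_imp_coercive_finite_codim[OF assms(2,3)] by blast
  obtain E where E: "orthonormal E" and D_E: "\<forall>d\<in>D. proj E d = d"
    using gram_schmidt[OF D] by blast
  have "ip w d = 0" if "\<forall>e\<in>E. ip w e = 0" "d \<in> D" for w d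
    using proj_orthogonal[OF that(1), of d] D_E that(2) ip_eq_0_commute[of d w] by simp
  then show ?thesis
    using coer by (intro finite_codim_coercive_imp_finite_rank_perturbation[OF A E b]) blast
qed

end

theorem theorem4p5:
  fixes scl :: "'k::real_or_complex \<Rightarrow> 'v::banach \<Rightarrow> 'v"
    and ip :: "'v \<Rightarrow> 'v \<Rightarrow> 'k"
    and A :: "'v \<Rightarrow>\<^sub>L ('v \<Rightarrow>\<^sub>L 'k)"
  assumes "hilbert_space scl ip"
    and "separable_space (euclidean :: 'v topology)"
    and "A \<in> operators scl"
  shows "(essentially_coercive scl A \<longleftrightarrow>
            (\<exists>K\<in>operators scl. finite_rank K \<and> coercive (A + K))) \<and>
         ((\<exists>K\<in>operators scl. finite_rank K \<and> coercive (A + K)) \<longleftrightarrow>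
            (\<exists>K\<in>operators scl. compact_operator K \<and> coercive (A + K)))"
proof -
  interpret hilbert_space scl ip by fact
  show ?thesis
    using essentially_coercive_imp_finite_rank_perturbation[OF assms(3) _ assms(2)]
      finite_rank_imp_compact_operator compact_perturbation_imp_essentially_coercive[OF assms(3)]
    by blast
qed

end
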